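(* Let $\Sigma$ be a finite alphabet with a fixed total order on its letters, and let $S=(S^+,S^-)$ be a finite labelled set of samples, where $S^+,S^-\subseteq\Sigma^*$ are finite and disjoint, whose words are listed in increasing lexicographic order $u_1<u_2<\dots<u_\ell$. Then the incremental construction algorithm (described in the context), run on this ordered list, returns a 3DFA $\mathcal M$ that recognises $S$ exactly, i.e. for every $u\in\Sigma^*$ we have $\mathcal M(u)=+$ if $u\in S^+$, $\mathcal M(u)=-$ if $u\in S^-$, and $\mathcal M(u)=\,?$ otherwise; and $\mathcal M$ is minimal, i.e. it has the smallest number of states among all 3DFAs that recognise $S$ exactly.
   Context: **3DFA.** A three-valued deterministic finite automaton (3DFA) over $\Sigma$ is a tuple $(Q,\iota,\delta,F,R)$, where $Q$ is a finite set of states, $\iota\in Q$ is the initial state, $\delta:Q\times\Sigma\rightharpoonup Q$ is a (partial) transition function, and $F,R\subseteq Q$ are disjoint sets of accepting and rejecting states; the states in $Q\setminus(F\cup R)$ are don't-care states. $\delta$ is extended to words in the usual way. A 3DFA $\mathcal A$ defines a function $\mathcal A:\Sigma^*\to\{+,-,?\}$: $\mathcal A(u)=+$ if $\delta(\iota,u)$ is defined and lies in $F$, $\mathcal A(u)=-$ if $\delta(\iota,u)$ is defined and lies in $R$, and $\mathcal A(u)=\,?$ otherwise (including when $\delta(\iota,u)$ is undefined). **Lexicographic order.** Words $u,u'$ are compared on their first $\min(|u|,|u'|)$ letters; at the first position where they differ, the word with the smaller letter is smaller. If there is no such position, the shorter word is smaller (and the words are equal if they have the same length). **State equivalence.** Two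 states $p,q$ of the current automaton satisfy $p\equiv q$ iff (1) they have the same status (both accepting, both rejecting, or both don't-care), and (2) for each letter $a\in\Sigma$, either $\delta(p,a)$ and $\delta(q,a)$ are both undefined, or both are defined and $\delta(p,a)=\delta(q,a)$. **The algorithm.** A state "has children" if it has at least one outgoing transition. $\mathsf{last\_child}(p)$ is the successor of $p$ over the largest letter $a$ for which $\delta(p,a)$ is defined; the assignment $\mathsf{last\_child}(p):=q$ redirects that transition to $q$. Main procedure: start with the automaton consisting of the single don't-care state $\iota$ without transitions, and with $Register:=\emptyset$. For each sample $u$ in the given order: - let $x$ be the longest prefix of $u$ such that $\delta(\iota,x)$ is defined in the current automaton, let $p:=\delta(\iota,x)$, and write $u=xy$; - if $p$ has children, call $\mathsf{replace\_or\_register}(p)$; - call $\mathsf{add\_suffix}(p,y)$: create a chain of $|y|$ fresh don't-care states starting from $p$ and reading $y$, and make the last state of this chain ($p$ itself if $y$ is empty) accepting if $u\in S^+$ and rejecting if $u\in S^-$. After all samples are processed, call $\mathsf{replace\_or\_register}(\iota)$ (this does nothing if $\iota$ has no children) and return the current automaton. $\mathsf{replace\_or\_register}(p)$: let $r:=\mathsf{last\_child}(p)$. If $r$ has children, call $\mathsf{replace\_or\_register}(r)$. Then, if there is a state $q\in Register$ with $q\equiv r$, set $\mathsf{last\_child}(p):=q$ (and delete the replaced state $r$); otherwise set $Register:=Register\cup\{r\}$. *)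

theory Defs
  imports Main "HOL-Library.Monad_Syntax"
begin

datatype verdict = Plus | Minus | Unknown

record ('q, 'a) tdfa =
  states :: "'q set"
  initial :: 'q
  trans :: "'q \<Rightarrow> 'a \<Rightarrow> 'q option"
  accepting :: "'q set"
  rejecting :: "'q set"

text \<open>The partial function from \<open>Q \<times> \<Sigma>\<close> to \<open>Q\<close> is represented by a map that is
  \<^const>\<open>None\<close> outside \<open>Q \<times> \<Sigma>\<close>.\<close>

definition is_3dfa :: "'a set \<Rightarrow> ('q, 'a) tdfa \<Rightarrow> bool" where
  "is_3dfa \<Sigma> A \<longleftrightarrow>
     finite (states A) \<and>
     initial A \<in> states A \<and>
     (\<forall>p a q. trans A p a = Some q \<longrightarrow> p \<in> states A \<and> a \<in> \<Sigma> \<and> q \<in> states A) \<and>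
     accepting A \<subseteq> states A \<and>
     rejecting A \<subseteq> states A \<and>
     accepting A \<inter> rejecting A = {}"

primrec delta :: "('q, 'a) tdfa \<Rightarrow> 'q \<Rightarrow> 'a list \<Rightarrow> 'q option" where
  "delta A p [] = Some p"
| "delta A p (a # w) = do { q \<leftarrow> trans A p a; delta A q w }"

definition status :: "('q, 'a) tdfa \<Rightarrow> 'q \<Rightarrow> verdict" where
  "status A q = (if q \<in> accepting A then Plus else if q \<in> rejecting A then Minus else Unknown)"

definition verdict_of :: "('q, 'a) tdfa \<Rightarrow> 'a list \<Rightarrow> verdict" where
  "verdict_of A u =
     (case delta A (initial A) u of None \<Rightarrow> Unknown | Some q \<Rightarrow> status A q)"

definition recognises ::
  "'a set \<Rightarrow> ('q, 'a) tdfa \<Rightarrow> 'a list set \<Rightarrow> 'a list set \<Rightarrow> bool" where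
  "recognises \<Sigma> A Sp Sn \<longleftrightarrow>
     (\<forall>u \<in> lists \<Sigma>. verdict_of A u = (if u \<in> Sp then Plus else if u \<in> Sn then Minus else Unknown))"

text \<open>\<^const>\<open>lexord\<close> makes a proper prefix smaller than its extensions.\<close>

definition lex_less :: "'a::linorder list \<Rightarrow> 'a list \<Rightarrow> bool" where
  "lex_less u v \<longleftrightarrow> (u, v) \<in> lexord {(a, b). a < b}"


definition state_equiv :: "'a set \<Rightarrow> ('q, 'a) tdfa \<Rightarrow> 'q \<Rightarrow> 'q \<Rightarrow> bool" where
  "state_equiv \<Sigma> A p q \<longleftrightarrow>
     status A p = status A q \<and> (\<forall>a \<in> \<Sigma>. trans A p a = trans A q a)"

definition has_children :: "('q, 'a) tdfa \<Rightarrow> 'q \<Rightarrow> bool" where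
  "has_children A p \<longleftrightarrow> dom (trans A p) \<noteq> {}"

definition last_letter :: "('q, 'a::linorder) tdfa \<Rightarrow> 'q \<Rightarrow> 'a" where
  "last_letter A p = Max (dom (trans A p))"

definition last_child :: "('q, 'a::linorder) tdfa \<Rightarrow> 'q \<Rightarrow> 'q" where
  "last_child A p = the (trans A p (last_letter A p))"

definition set_last_child ::
  "'q \<Rightarrow> 'q \<Rightarrow> ('q, 'a::linorder) tdfa \<Rightarrow> ('q, 'a) tdfa" where
  "set_last_child p q A =
     A\<lparr>trans := (trans A)(p := (trans A p)(last_letter A p \<mapsto> q))\<rparr>"

definition delete_state :: "'q \<Rightarrow> ('q, 'a) tdfa \<Rightarrow> ('q, 'a) tdfa" where
  "delete_state r A =
     A\<lparr>states := states A - {r},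
       trans := (\<lambda>p a. if p = r \<or> trans A p a = Some r then None else trans A p a),
       accepting := accepting A - {r},
       rejecting := rejecting A - {r}\<rparr>"

text \<open>Below, a pair of type \<open>('q, 'a) tdfa \<times> 'q set\<close> is the current automaton together with
  the register. The recursion in \<open>replace_or_register\<close> follows transitions of the current
  automaton, so it need not terminate on an arbitrary one; \<^const>\<open>None\<close> stands for divergence.\<close>

partial_function (option) replace_or_register ::
  "'a::linorder set \<Rightarrow> ('q, 'a) tdfa \<times> 'q set \<Rightarrow> 'q \<Rightarrow> (('q, 'a) tdfa \<times> 'q set) option" where
  "replace_or_register \<Sigma> c p = (let r = last_child (fst c) p in
     do {
       (A, Reg) \<leftarrow> (if has_children (fst c) r then replace_or_register \<Sigma> c r else Some c);
       Some (if \<exists>q \<in> Reg. state_equiv \<Sigma> A q r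
             then (delete_state r
                     (set_last_child p (SOME q. q \<in> Reg \<and> state_equiv \<Sigma> A q r) A), Reg)
             else (A, insert r Reg))
     })"

text \<open>Automata under construction have states named by natural numbers.\<close>

definition fresh :: "(nat, 'a) tdfa \<Rightarrow> nat" where
  "fresh A = (SOME q. q \<notin> states A)"

definition add_child :: "nat \<Rightarrow> 'a \<Rightarrow> nat \<Rightarrow> (nat, 'a) tdfa \<Rightarrow> (nat, 'a) tdfa" where
  "add_child p a q A =
     A\<lparr>states := insert q (states A), trans := (trans A)(p := (trans A p)(a \<mapsto> q))\<rparr>"

definition mark_state ::
  "'a list set \<Rightarrow> 'a list set \<Rightarrow> 'a list \<Rightarrow> nat \<Rightarrow> (nat, 'a) tdfa \<Rightarrow> (nat, 'a) tdfa" where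
  "mark_state Sp Sn u q A =
     A\<lparr>accepting := (if u \<in> Sp then insert q (accepting A) else accepting A),
       rejecting := (if u \<in> Sn then insert q (rejecting A) else rejecting A)\<rparr>"

text \<open>The argument \<open>u\<close> is the whole sample, which determines the mark of the last state;
  the final argument is the suffix still to be read from \<open>p\<close>.\<close>

fun add_suffix ::
  "'a list set \<Rightarrow> 'a list set \<Rightarrow> 'a list \<Rightarrow> (nat, 'a) tdfa \<Rightarrow> nat \<Rightarrow> 'a list \<Rightarrow> (nat, 'a) tdfa" where
  "add_suffix Sp Sn u A p [] = mark_state Sp Sn u p A"
| "add_suffix Sp Sn u A p (a # y) =
     (let q = fresh A in add_suffix Sp Sn u (add_child p a q A) q y)"

definition longest_prefix_length :: "('q, 'a) tdfa \<Rightarrow> 'a list \<Rightarrow> nat" where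
  "longest_prefix_length A u =
     (GREATEST n. n \<le> length u \<and> delta A (initial A) (take n u) \<noteq> None)"

definition process_sample ::
  "'a::linorder set \<Rightarrow> 'a list set \<Rightarrow> 'a list set \<Rightarrow> 'a list \<Rightarrow>
   (nat, 'a) tdfa \<times> nat set \<Rightarrow> ((nat, 'a) tdfa \<times> nat set) option" where
  "process_sample \<Sigma> Sp Sn u c =
     (let n = longest_prefix_length (fst c) u;
          x = take n u;
          y = drop n u;
          p = the (delta (fst c) (initial (fst c)) x)
      in do {
        (A, Reg) \<leftarrow> (if has_children (fst c) p then replace_or_register \<Sigma> c p else Some c);
        Some (add_suffix Sp Sn u A p y, Reg)
      })"

primrec process_samples ::
  "'a::linorder set \<Rightarrow> 'a list set \<Rightarrow> 'a list set \<Rightarrow> 'a list list \<Rightarrow>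
   (nat, 'a) tdfa \<times> nat set \<Rightarrow> ((nat, 'a) tdfa \<times> nat set) option" where
  "process_samples \<Sigma> Sp Sn [] c = Some c"
| "process_samples \<Sigma> Sp Sn (u # us) c =
     do { c' \<leftarrow> process_sample \<Sigma> Sp Sn u c; process_samples \<Sigma> Sp Sn us c' }"

definition start_tdfa :: "(nat, 'a) tdfa" where
  "start_tdfa =
     \<lparr>states = {0}, initial = 0, trans = (\<lambda>_ _. None), accepting = {}, rejecting = {}\<rparr>"

definition construct ::
  "'a::linorder set \<Rightarrow> 'a list set \<Rightarrow> 'a list set \<Rightarrow> 'a list list \<Rightarrow> (nat, 'a) tdfa option" where
  "construct \<Sigma> Sp Sn us = do {
     (A, Reg) \<leftarrow> process_samples \<Sigma> Sp Sn us (start_tdfa, {});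
     (A', Reg') \<leftarrow> (if has_children A (initial A)
                    then replace_or_register \<Sigma> (A, Reg) (initial A) else Some (A, Reg));
     Some A'
   }"

end

theory Submission imports Defs begin

text \<open>The residual of a state maps a word to its verdict when read from that state. Call a residual
  trivial if it is constantly \<open>Unknown\<close>. The register is closed under transitions, and its states have
  nontrivial and pairwise distinct residuals. So a state \<open>r\<close> with all children registered is equivalent
  to a registered state iff the two have the same residual, and registering or merging \<open>r\<close> keeps the
  invariant; merging is a homomorphism sending \<open>r\<close> to its representative, hence preserves verdicts and
  reachability. Since the samples are sorted, the next one leaves the active path at a state all of
  whose outgoing letters are smaller than the next letter. In the end all states have distinct
  residuals (that of the initial state differs from the others since the language is finite), which
  bounds below the number of states of any automaton with the same verdicts.\<close>

section \<open>Residuals and homomorphisms of automata\<close>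

definition residual :: "('q, 'a) tdfa \<Rightarrow> 'q \<Rightarrow> 'a list \<Rightarrow> verdict" where
  "residual A p w = (case delta A p w of None \<Rightarrow> Unknown | Some q \<Rightarrow> status A q)"

lemma verdict_of_residual: "verdict_of A w = residual A (initial A) w"
  by (simp add: verdict_of_def residual_def)

lemma delta_append: "delta A p (v @ w) = Option.bind (delta A p v) (\<lambda>q. delta A q w)"
  by (induction v arbitrary: p) (auto split: bind_split)

lemma residual_Nil [simp]: "residual A p [] = status A p"
  by (simp add: residual_def)

lemma residual_Cons:
  "residual A p (a # w) = (case trans A p a of None \<Rightarrow> Unknown | Some q \<Rightarrow> residual A q w)"
  by (simp add: residual_def split: option.split)

lemma residual_append:
  "residual A p (v @ w) = (case delta A p v of None \<Rightarrow> Unknown | Some q \<Rightarrow> residual A q w)"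
  by (simp add: residual_def delta_append split: option.split)

lemma delta_closed:
  assumes "p \<in> C" "delta A p w = Some q"
    and "\<And>s a t. s \<in> C \<Longrightarrow> trans A s a = Some t \<Longrightarrow> t \<in> C"
  shows "q \<in> C"
  using assms(1,2)
proof (induction w arbitrary: p)
  case (Cons a w)
  then show ?case using assms(3) by (cases "trans A p a") auto
qed simp

text \<open>The map \<open>h\<close> may identify states: it will be the collapse of a replaced
  state onto its registered representative.\<close>

lemma delta_hom:
  assumes "p \<in> C"
    and "\<And>s a. s \<in> C \<Longrightarrow> trans A' (h s) a = map_option h (trans A s a)"
    and "\<And>s a t. s \<in> C \<Longrightarrow> trans A s a = Some t \<Longrightarrow> t \<in> C"
  shows "delta A' (h p) w = map_option h (delta A p w)"
  using assms(1)
proof (induction w arbitrary: p)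
  case (Cons a w)
  then show ?case using assms(2,3) by (cases "trans A p a") auto
qed simp

lemma residual_hom:
  assumes "p \<in> C"
    and "\<And>s a. s \<in> C \<Longrightarrow> trans A' (h s) a = map_option h (trans A s a)"
    and "\<And>s a t. s \<in> C \<Longrightarrow> trans A s a = Some t \<Longrightarrow> t \<in> C"
    and "\<And>s. s \<in> C \<Longrightarrow> status A' (h s) = status A s"
  shows "residual A' (h p) w = residual A p w"
proof -
  have "delta A' (h p) w = map_option h (delta A p w)"
    using assms(1-3) by (rule delta_hom)
  moreover have "q \<in> C" if "delta A p w = Some q" for q
    using assms(1) that assms(3) by (rule delta_closed)
  ultimately show ?thesis
    using assms(4) by (cases "delta A p w") (auto simp: residual_def)
qed

lemma delta_in_lists:
  assumes "is_3dfa \<Sigma> A" "delta A p w \<noteq> None"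
  shows "w \<in> lists \<Sigma>"
  using assms(2)
proof (induction w arbitrary: p)
  case (Cons a w)
  then show ?case using assms(1) by (cases "trans A p a") (auto simp: is_3dfa_def)
qed simp

lemma delta_states:
  assumes "is_3dfa \<Sigma> A" "p \<in> states A" "delta A p w = Some q"
  shows "q \<in> states A"
  using assms(2,3) by (rule delta_closed) (use assms(1) in \<open>auto simp: is_3dfa_def\<close>)

section \<open>Lexicographic order\<close>

lemma lex_less_irrefl: "\<not> lex_less u u"
  by (simp add: lex_less_def lexord_irreflexive)

lemma lex_less_Cons [simp]: "lex_less (a # u) (b # v) \<longleftrightarrow> a < b \<or> a = b \<and> lex_less u v"
  by (simp add: lex_less_def)

lemma not_lex_less_Nil [simp]: "\<not> lex_less u []"
  by (simp add: lex_less_def)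

lemma lex_less_append_left [simp]: "lex_less (x @ u) (x @ v) \<longleftrightarrow> lex_less u v"
  by (induction x) auto

text \<open>Words with a common prefix form an interval of the order. Hence a prefix that the new
  sample shares with any earlier one is shared with the latest one too.\<close>

lemma lex_less_convex_prefix:
  assumes "v = w \<or> lex_less v w" "lex_less w u"
    and "v = x @ v'" "u = x @ u'"
  shows "\<exists>w'. w = x @ w'"
  using assms
proof (induction x arbitrary: v w u)
  case (Cons c x)
  show ?case
  proof (cases w)
    case Nil
    then show ?thesis using Cons.prems by auto
  next
    case (Cons d w0)
    then show ?thesis
      using Cons.IH[of "x @ v'" w0 "x @ u'"] Cons.prems by auto
  qed
qed simp

section \<open>Automata with an active path\<close>

text \<open>The list \<open>ps\<close> is the active path: the states read by the last sample that are not yet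
  registered. Only the path step enters a state of \<open>ps\<close>, and it does so over the largest letter.\<close>

locale spined =
  fixes \<Sigma> :: "'a::linorder set" and A :: "('q, 'a) tdfa" and Reg :: "'q set" and ps :: "'q list"
  assumes dfa: "is_3dfa \<Sigma> A"
    and alphabet: "finite \<Sigma>"
    and path_nonempty: "ps \<noteq> []"
    and path_hd: "hd ps = initial A"
    and path_distinct: "distinct ps"
    and path_Reg: "set ps \<inter> Reg = {}"
    and states_eq: "states A = set ps \<union> Reg"
    and edge: "\<And>p a q. trans A p a = Some q \<Longrightarrow>
      q \<in> Reg \<or> (\<exists>xs ys. ps = xs @ p # q # ys \<and> a = last_letter A p)"
    and path_edge: "\<And>xs p q ys. ps = xs @ p # q # ys \<Longrightarrow> trans A p (last_letter A p) = Some q"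
    and reachable: "\<And>q. q \<in> states A \<Longrightarrow> \<exists>x. delta A (initial A) x = Some q"
    and Reg_nontrivial: "\<And>q. q \<in> Reg \<Longrightarrow> \<exists>z. residual A q z \<noteq> Unknown"
    and Reg_inj: "\<And>q q'. q \<in> Reg \<Longrightarrow> q' \<in> Reg \<Longrightarrow> residual A q = residual A q' \<Longrightarrow> q = q'"
begin

lemma edge_states: "trans A p a = Some q \<Longrightarrow> p \<in> states A \<and> a \<in> \<Sigma> \<and> q \<in> states A"
  using dfa by (auto simp: is_3dfa_def)

lemma finite_dom: "finite (dom (trans A p))"
  by (rule finite_subset[OF _ alphabet]) (auto dest: edge_states)

lemma initial_state: "initial A \<in> states A"
  using dfa by (simp add: is_3dfa_def)

lemma Reg_closed: "p \<in> Reg \<Longrightarrow> trans A p a = Some q \<Longrightarrow> q \<in> Reg"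
  using edge[of p a q] path_Reg by auto

text \<open>A path state is unregistered, so \<open>edge\<close> makes every transition into it a
  path step, and \<open>path_distinct\<close> leaves only one position for \<open>r\<close>.\<close>

lemma into_path:
  assumes "trans A s a = Some r" "ps = xs @ p # r # ys"
  shows "s = p \<and> a = last_letter A p"
proof -
  have "r \<notin> Reg" using path_Reg assms(2) by auto
  then obtain xs' ys' where e: "ps = xs' @ s # r # ys'" "a = last_letter A s"
    using edge[OF assms(1)] by auto
  have "(xs @ [p]) @ r # ys = (xs' @ [s]) @ r # ys'" using assms(2) e by simp
  moreover have "r \<notin> set (xs @ [p])" "r \<notin> set ys"
    using path_distinct assms(2) by auto
  ultimately have "xs @ [p] = xs' @ [s]"
    using append_Cons_eq_iff[of r "xs @ [p]" ys "xs' @ [s]" ys'] by simp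
  then show ?thesis using e by simp
qed

text \<open>A transition to an unregistered state would be a path step out of the last state of the
  path.\<close>

lemma from_last:
  assumes "ps = xs @ [r]" "trans A r a = Some q"
  shows "q \<in> Reg"
proof (rule ccontr)
  assume "q \<notin> Reg"
  then obtain xs' ys' where e: "ps = xs' @ r # q # ys'" using edge[OF assms(2)] by auto
  have "r \<notin> set xs" using path_distinct assms(1) by simp
  then show False
    using assms(1) e append_Cons_eq_iff[of r xs "[]" xs' "q # ys'"] by simp
qed

text \<open>Such an edge would be a path step, giving \<open>hd ps\<close> a predecessor on a path
  without repetitions.\<close>

lemma no_edge_into_initial: "trans A s a \<noteq> Some (initial A)"
proof
  assume t: "trans A s a = Some (initial A)"
  have i: "initial A \<in> set ps" using path_hd path_nonempty hd_in_set by fastforce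
  then have "initial A \<notin> Reg" using path_Reg by auto
  then obtain xs ys where e: "ps = xs @ s # initial A # ys" using edge[OF t] by auto
  have "initial A \<in> set (xs @ [s])" using e path_hd by (cases xs) auto
  then show False using e path_distinct by auto
qed

lemma path_delta:
  "ps = xs @ p # ys \<Longrightarrow> delta A (initial A) (map (last_letter A) xs) = Some p"
proof (induction xs arbitrary: p ys rule: rev_induct)
  case Nil
  then show ?case using path_hd by simp
next
  case (snoc s xs)
  then show ?case using path_edge[of xs s p ys] by (simp add: delta_append)
qed

text \<open>Tracing a run backwards, \<open>into_path\<close> forces every step up to the initial
  state, which nothing enters. So a change of status at a path state affects the verdict of a single
  word.\<close>

lemma path_delta_unique:
  "ps = xs @ p # ys \<Longrightarrow> delta A (initial A) v = Some p \<Longrightarrow> v = map (last_letter A) xs"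
proof (induction xs arbitrary: p ys v rule: rev_induct)
  case Nil
  then have "p = initial A" using path_hd by simp
  then show ?case
    using Nil no_edge_into_initial
    by (cases v rule: rev_cases) (auto simp: delta_append split: bind_splits)
next
  case (snoc s xs)
  show ?case
  proof (cases v rule: rev_cases)
    case Nil
    then have "p = hd ps" using snoc.prems path_hd by simp
    then show ?thesis using snoc.prems(1) path_distinct by (cases xs) auto
  next
    case (snoc v' a)
    then obtain t where t: "delta A (initial A) v' = Some t" "trans A t a = Some p"
      using snoc.prems(2) by (auto simp: delta_append split: bind_splits)
    have "t = s \<and> a = last_letter A s"
      using into_path[OF t(2), of xs s ys] snoc.prems(1) by simp
    then show ?thesis using snoc.IH[of s "p # ys" v'] snoc.prems(1) t(1) snoc by simp
  qed
qed

lemma initial_unique: "delta A (initial A) v = Some (initial A) \<Longrightarrow> v = []"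
  using path_delta_unique[of "[]" "initial A" "tl ps" v] path_hd path_nonempty
  by (metis append_Nil list.collapse list.simps(8))

text \<open>Residuals determine registered states, and they are nontrivial, so an equality of residuals
  forces equal status and equal successors.\<close>

lemma state_equiv_if_residual_eq:
  assumes "ps = xs @ [r]" "q \<in> Reg" "residual A q = residual A r"
  shows "state_equiv \<Sigma> A q r"
  unfolding state_equiv_def
proof (intro conjI ballI)
  show "status A q = status A r" using fun_cong[OF assms(3), of "[]"] by simp
next
  fix a assume "a \<in> \<Sigma>"
  have e: "residual A q (a # z) = residual A r (a # z)" for z using assms(3) by simp
  \<comment> \<open>The register is closed under transitions and \<open>r\<close> ends the path, so
    all successors on both sides are registered.\<close>
  have R: "s \<in> Reg" if "trans A q a = Some s \<or> trans A r a = Some s" for s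
    using that Reg_closed[OF assms(2)] from_last[OF assms(1)] by auto
  show "trans A q a = trans A r a"
  proof (cases "trans A q a")
    case None
    have "trans A r a \<noteq> Some s'" for s'
    proof
      assume s': "trans A r a = Some s'"
      then obtain z where "residual A s' z \<noteq> Unknown" using R Reg_nontrivial by blast
      then show False using e[of z] None s' by (simp add: residual_Cons)
    qed
    then have "trans A r a = None" by (cases "trans A r a") auto
    then show ?thesis using None by simp
  next
    case (Some s)
    then obtain z where "residual A s z \<noteq> Unknown" using R Reg_nontrivial by blast
    then have "residual A r (a # z) \<noteq> Unknown"
      using e[of z] Some by (simp add: residual_Cons)
    then obtain s' where s': "trans A r a = Some s'"
      by (cases "trans A r a") (auto simp: residual_Cons)
    then have "residual A s = residual A s'"
      using e Some by (auto simp: residual_Cons)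
    then show ?thesis using Some s' R Reg_inj[of s s'] by simp
  qed
qed

end

section \<open>Registering or merging the last path state\<close>

text \<open>All successors of \<open>r\<close> are registered, so by the contrapositive of
  \<open>state_equiv_if_residual_eq\<close> its residual is new to the register, and
  \<open>Reg_inj\<close> survives.\<close>

lemma spined_register:
  assumes "spined \<Sigma> A Reg (xs @ [p, r])" "\<exists>z. residual A r z \<noteq> Unknown"
    and "\<not> (\<exists>q\<in>Reg. state_equiv \<Sigma> A q r)"
  shows "spined \<Sigma> A (insert r Reg) (xs @ [p])"
proof -
  interpret spined \<Sigma> A Reg "xs @ [p, r]" by fact
  have l: "xs @ [p, r] = (xs @ [p]) @ [r]" by simp
  have N: "residual A q \<noteq> residual A r" if "q \<in> Reg" for q
    using state_equiv_if_residual_eq[OF l that] assms(3) that by blast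
  show ?thesis
  proof
    show "hd (xs @ [p]) = initial A" using path_hd by (cases xs) auto
    fix s a t assume t: "trans A s a = Some t"
    show "t \<in> insert r Reg \<or> (\<exists>xsa ys. xs @ [p] = xsa @ s # t # ys \<and> a = last_letter A s)"
    proof (cases "t \<in> insert r Reg")
      case False
      then obtain xs' ys where e: "xs @ [p, r] = xs' @ s # t # ys" "a = last_letter A s"
        using edge[OF t] by auto
      \<comment> \<open>The target is not \<open>r\<close>, so this path step is not the final one
        and survives dropping \<open>r\<close> from the path.\<close>
      have "ys \<noteq> []" using e(1) False by auto
      then obtain ys' where "ys = ys' @ [r]" using e(1)
        by (metis append.assoc append_Cons append_Nil last.simps last_appendR list.discI append_butlast_last_id)
      then show ?thesis using e by auto
    qed simp
  next
    fix xs' s t ys assume "xs @ [p] = xs' @ s # t # ys"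
    then have "xs @ [p, r] = xs' @ s # t # (ys @ [r])" using l by simp
    then show "trans A s (last_letter A s) = Some t" by (rule path_edge)
  next
    fix q q' assume "q \<in> insert r Reg" "q' \<in> insert r Reg" "residual A q = residual A q'"
    then show "q = q'" using N Reg_inj by (metis insertE)
  qed (use dfa alphabet path_distinct path_Reg states_eq reachable Reg_nontrivial assms(2) in auto)
qed

text \<open>The other outcome: \<open>r\<close> is replaced by an equivalent registered
  \<open>q\<close>, and the path then ends in \<open>p\<close>.\<close>

locale spined_merge = spined \<Sigma> A Reg "xs @ [p, r]"
  for \<Sigma> :: "'a::linorder set" and A :: "('q, 'a) tdfa" and Reg xs p r +
  fixes q
  assumes q_Reg: "q \<in> Reg" and q_equiv: "state_equiv \<Sigma> A q r"
begin

abbreviation "B \<equiv> delete_state r (set_last_child p q A)"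
text \<open>The collapse of \<open>r\<close> onto \<open>q\<close>, a homomorphism from
  \<open>A\<close> to \<open>B\<close> that is also defined on the deleted state.\<close>

abbreviation "h s \<equiv> if s = r then q else s"

lemma path_facts: "r \<noteq> p" "r \<noteq> q" "p \<noteq> q" "r \<notin> set xs" "p \<notin> set xs" "r \<notin> Reg" "p \<notin> Reg" "r \<noteq> initial A"
proof -
  show "r \<noteq> p" "r \<noteq> q" "p \<noteq> q" "r \<notin> set xs" "p \<notin> set xs" "r \<notin> Reg" "p \<notin> Reg"
    using path_distinct path_Reg q_Reg by auto
  then show "r \<noteq> initial A" using path_hd by (cases xs) auto
qed

lemma trans_p: "trans A p (last_letter A p) = Some r"
  using path_edge[of xs p r "[]"] by simp

text \<open>State equivalence compares letters of \<open>\<Sigma>\<close> only; over any other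
  letter both transitions are undefined.\<close>

lemma trans_q: "trans A q a = trans A r a"
proof (cases "a \<in> \<Sigma>")
  case True
  then show ?thesis using q_equiv by (simp add: state_equiv_def)
next
  case False
  then have "trans A s a = None" for s using edge_states by (cases "trans A s a") auto
  then show ?thesis by simp
qed

lemma into_r: "trans A s a = Some r \<longleftrightarrow> s = p \<and> a = last_letter A p"
  using into_path[of s a r xs p "[]"] trans_p by auto

text \<open>\<open>delete_state\<close> drops the edges into \<open>r\<close>, but by
  \<open>into_r\<close> the only such edge was redirected to \<open>q\<close> beforehand, so no
  other state loses a transition.\<close>

lemma trans_B: "s \<noteq> r \<Longrightarrow> trans B s a = map_option h (trans A s a)"
  using into_r[of s a] path_facts trans_p
  by (cases "trans A s a") (auto simp: delete_state_def set_last_child_def)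

lemma hom_trans: "trans B (h s) a = map_option h (trans A s a)"
proof (cases "s = r")
  case True
  then show ?thesis using trans_B[of q a] trans_q[of a] path_facts(2) by simp
next
  case False
  then show ?thesis using trans_B[of s a] by simp
qed

lemma states_B: "states B = states A - {r}"
  by (simp add: delete_state_def set_last_child_def)

lemma initial_B: "initial B = initial A"
  by (simp add: delete_state_def set_last_child_def)

lemma hom_status: "status B (h s) = status A s"
  using q_equiv path_facts
  by (auto simp: state_equiv_def status_def delete_state_def set_last_child_def split: if_splits)

lemma delta_B: "delta B (h s) w = map_option h (delta A s w)"
  using UNIV_I hom_trans by (rule delta_hom) simp

lemma residual_B: "residual B (h s) w = residual A s w"
  using UNIV_I hom_trans _ hom_status by (rule residual_hom) simp

lemma residual_B': "s \<noteq> r \<Longrightarrow> residual B s = residual A s"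
  using residual_B[of s] by (intro ext) simp

text \<open>Merging changes targets but no letters, so last letters survive, and with them the word
  spelled by the path.\<close>

lemma dom_B: "s \<noteq> r \<Longrightarrow> dom (trans B s) = dom (trans A s)"
  by (simp add: dom_def trans_B)

lemma last_letter_B: "s \<noteq> r \<Longrightarrow> last_letter B s = last_letter A s"
  using dom_B by (simp add: last_letter_def)

lemma verdict_B: "verdict_of B w = verdict_of A w"
  using residual_B'[of "initial A"] path_facts initial_B by (simp add: verdict_of_residual)

text \<open>Every condition transfers along \<open>h\<close>, which fixes all states except
  \<open>r\<close>.\<close>

lemma spined_B: "spined \<Sigma> B Reg (xs @ [p])"
proof
  have tr: "s \<in> states B \<and> a \<in> \<Sigma> \<and> t \<in> states B" if t: "trans B s a = Some t" for s a t
  proof -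
    have "s \<noteq> r" using t by (auto simp: delete_state_def)
    then obtain t' where "trans A s a = Some t'" "t = h t'"
      using t trans_B[OF \<open>s \<noteq> r\<close>, of a] by (auto simp only: map_option_eq_Some)
    then show ?thesis using edge_states[of s a t'] \<open>s \<noteq> r\<close> states_B q_Reg states_eq path_facts by auto
  qed
  show "is_3dfa \<Sigma> B"
    unfolding is_3dfa_def
  proof (intro conjI allI impI)
    show "initial B \<in> states B" using states_B initial_B path_facts initial_state by auto
    show "finite (states B)" using dfa states_B by (simp add: is_3dfa_def)
    show "s \<in> states B" "a \<in> \<Sigma>" "t \<in> states B" if "trans B s a = Some t" for s a t
      using tr[OF that] by blast+
    show "accepting B \<subseteq> states B" "rejecting B \<subseteq> states B" "accepting B \<inter> rejecting B = {}"
      using dfa by (auto simp: is_3dfa_def delete_state_def set_last_child_def)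
  qed
  show "hd (xs @ [p]) = initial B" using path_hd initial_B by (cases xs) auto
  show "states B = set (xs @ [p]) \<union> Reg" using states_B states_eq path_facts by auto
  fix s a t assume t: "trans B s a = Some t"
  have "s \<noteq> r" using t by (auto simp: delete_state_def)
  then obtain t' where t': "trans A s a = Some t'" "t = h t'"
    using t trans_B[OF \<open>s \<noteq> r\<close>, of a] by (auto simp only: map_option_eq_Some)
  show "t \<in> Reg \<or> (\<exists>xsa ys. xs @ [p] = xsa @ s # t # ys \<and> a = last_letter B s)"
  proof (cases "t \<in> Reg")
    case False
    \<comment> \<open>A target outside the register is not \<open>q\<close>, so \<open>h\<close> has
      not moved it and the edge was already a path step of \<open>A\<close>.\<close>
    then have tt: "t' = t" "t \<noteq> r" using t' q_Reg by (auto split: if_splits)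
    then obtain xs' ys where e: "xs @ [p, r] = xs' @ s # t # ys" "a = last_letter A s"
      using edge[OF t'(1)] False by auto
    have "ys \<noteq> []" using e(1) tt by auto
    then obtain ys' where "ys = ys' @ [r]" using e(1)
      by (metis append.assoc append_Cons append_Nil last.simps last_appendR list.discI append_butlast_last_id)
    then show ?thesis using e last_letter_B \<open>s \<noteq> r\<close> by auto
  qed simp
next
  fix xs' s t ys assume e: "xs @ [p] = xs' @ s # t # ys"
  then have "xs @ [p, r] = xs' @ s # t # (ys @ [r])"
    by (metis append.assoc append_Cons append_Nil)
  then have "trans A s (last_letter A s) = Some t" by (rule path_edge)
  moreover have "s \<noteq> r \<and> t \<noteq> r"
  proof -
    have "s \<in> set (xs @ [p])" "t \<in> set (xs @ [p])" by (auto simp: e)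
    then show ?thesis using path_facts by auto
  qed
  ultimately show "trans B s (last_letter B s) = Some t"
    using trans_B last_letter_B by simp
next
  fix s assume s: "s \<in> states B"
  then obtain x where "delta A (initial A) x = Some s" using reachable states_B by auto
  then show "\<exists>x. delta B (initial B) x = Some s"
    using delta_B[of "initial A" x] path_facts initial_B s states_B by (intro exI[of _ x]) auto
next
  fix s assume "s \<in> Reg"
  then show "\<exists>z. residual B s z \<noteq> Unknown" using Reg_nontrivial residual_B' path_facts by metis
next
  fix s s' assume "s \<in> Reg" "s' \<in> Reg" "residual B s = residual B s'"
  then show "s = s'" using Reg_inj residual_B' path_facts by metis
qed (use alphabet path_distinct path_Reg in auto)

end

section \<open>The recursion along the active path\<close>

text \<open>The initial state is exempt because it is trivial before the first sample. The condition
  is separate from \<open>spined\<close> because it fails while \<open>add_suffix\<close> builds its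
  chain.\<close>

definition nontrivial :: "('q, 'a) tdfa \<Rightarrow> bool" where
  "nontrivial A \<longleftrightarrow> (\<forall>q\<in>states A. q \<noteq> initial A \<longrightarrow> (\<exists>z. residual A q z \<noteq> Unknown))"

text \<open>Here \<open>c'\<close> is what the body of \<open>replace_or_register\<close> computes
  after its recursive call. The clause on domains ensures that the path still spells the same
  word.\<close>

lemma replace_or_register_step:
  assumes "spined \<Sigma> A Reg (xs @ [p, r])" "nontrivial A"
    and c: "c' = (if \<exists>q \<in> Reg. state_equiv \<Sigma> A q r
             then (delete_state r
                     (set_last_child p (SOME q. q \<in> Reg \<and> state_equiv \<Sigma> A q r) A), Reg)
             else (A, insert r Reg))"
  shows "spined \<Sigma> (fst c') (snd c') (xs @ [p]) \<and> nontrivial (fst c') \<and>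
    verdict_of (fst c') = verdict_of A \<and>
    (\<forall>s\<in>set (xs @ [p]). dom (trans (fst c') s) = dom (trans A s))"
proof (cases "\<exists>q \<in> Reg. state_equiv \<Sigma> A q r")
  case True
  define q where "q = (SOME q. q \<in> Reg \<and> state_equiv \<Sigma> A q r)"
  have q: "q \<in> Reg \<and> state_equiv \<Sigma> A q r"
    unfolding q_def by (rule someI_ex) (use True in blast)
  interpret spined_merge \<Sigma> A Reg xs p r q
    using assms(1) q by (simp add: spined_merge_def spined_merge_axioms_def)
  have "c' = (B, Reg)" using c True q_def by simp
  moreover have "nontrivial B"
    using assms(2) states_B initial_B residual_B' by (simp add: nontrivial_def)
  moreover have "dom (trans B s) = dom (trans A s)" if "s \<in> set (xs @ [p])" for s
    using that dom_B[of s] path_facts by auto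
  ultimately show ?thesis using spined_B verdict_B by auto
next
  case False
  interpret spined \<Sigma> A Reg "xs @ [p, r]" by fact
  \<comment> \<open>\<open>r\<close> comes after \<open>p\<close> on the path, so it is not the
    exempt initial state and is nontrivial.\<close>
  have "r \<in> states A" "r \<noteq> initial A"
    using states_eq path_hd path_distinct by (cases xs; auto)+
  then have "\<exists>z. residual A r z \<noteq> Unknown" using assms(2) by (auto simp: nontrivial_def)
  then show ?thesis using spined_register[OF assms(1) _ False] c False assms(2) by simp
qed

text \<open>By \<open>path_edge\<close>, following last children means walking down the path. The
  recursion therefore stops at its childless end, and induction on the remaining path yields
  termination and the invariant together.\<close>

lemma replace_or_register_spined:
  assumes "spined \<Sigma> A Reg (xs @ p # r # ys)" "nontrivial A"
    and "\<not> has_children A (last (r # ys))"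
  shows "\<exists>A' Reg'. replace_or_register \<Sigma> (A, Reg) p = Some (A', Reg') \<and>
    spined \<Sigma> A' Reg' (xs @ [p]) \<and> nontrivial A' \<and> verdict_of A' = verdict_of A \<and>
    (\<forall>s\<in>set (xs @ [p]). dom (trans A' s) = dom (trans A s))"
  using assms
proof (induction ys arbitrary: xs p r)
  case Nil
  interpret spined \<Sigma> A Reg "xs @ [p, r]" using Nil by simp
  have lc: "last_child A p = r" using path_edge[of xs p r "[]"] by (simp add: last_child_def)
  define c' where "c' = (if \<exists>q \<in> Reg. state_equiv \<Sigma> A q r
             then (delete_state r
                     (set_last_child p (SOME q. q \<in> Reg \<and> state_equiv \<Sigma> A q r) A), Reg)
             else (A, insert r Reg))"
  have "replace_or_register \<Sigma> (A, Reg) p = Some c'"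
    unfolding c'_def using lc Nil by (subst replace_or_register.simps) (simp add: Let_def)
  then show ?case
    using replace_or_register_step[OF _ _ c'_def] Nil by (cases c') auto
next
  case (Cons r' ys)
  interpret spined \<Sigma> A Reg "xs @ p # r # r' # ys" using Cons by simp
  have lc: "last_child A p = r" using path_edge[of xs p r "r' # ys"] by (simp add: last_child_def)
  have ch: "has_children A r"
    using path_edge[of "xs @ [p]" r r' ys] by (auto simp: has_children_def)
  \<comment> \<open>The inner call makes \<open>r\<close> the end of the path, which is the
    situation of \<open>replace_or_register_step\<close>.\<close>
  obtain A1 Reg1 where 1: "replace_or_register \<Sigma> (A, Reg) r = Some (A1, Reg1)"
    "spined \<Sigma> A1 Reg1 (xs @ [p, r])" "nontrivial A1" "verdict_of A1 = verdict_of A"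
    "\<forall>s\<in>set (xs @ [p, r]). dom (trans A1 s) = dom (trans A s)"
    using Cons.IH[of "xs @ [p]" r r'] Cons.prems by auto
  define c' where "c' = (if \<exists>q \<in> Reg1. state_equiv \<Sigma> A1 q r
             then (delete_state r
                     (set_last_child p (SOME q. q \<in> Reg1 \<and> state_equiv \<Sigma> A1 q r) A1), Reg1)
             else (A1, insert r Reg1))"
  have "replace_or_register \<Sigma> (A, Reg) p = Some c'"
    unfolding c'_def using lc ch 1(1) by (subst replace_or_register.simps) (simp add: Let_def)
  then show ?case
    using replace_or_register_step[OF 1(2,3) c'_def] 1(4,5) by (cases c') auto
qed

section \<open>Extending the path by a new suffix\<close>

lemma fresh_not_in: "finite (states A) \<Longrightarrow> fresh A \<notin> states A"
  unfolding fresh_def by (rule someI_ex) (rule ex_new_if_finite[OF infinite_UNIV_nat])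

text \<open>One link of the chain. By \<open>b_max\<close> the new edge becomes the last one at
  \<open>p\<close>, so the extended path still runs over largest letters.\<close>

locale spined_extend = spined \<Sigma> A Reg "xs @ [p]"
  for \<Sigma> :: "'a::linorder set" and A :: "(nat, 'a) tdfa" and Reg xs p +
  fixes b q
  assumes b_\<Sigma>: "b \<in> \<Sigma>" and b_max: "\<And>c. c \<in> dom (trans A p) \<Longrightarrow> c < b"
    and q_new: "q \<notin> states A"
begin

abbreviation "C \<equiv> add_child p b q A"

lemma trans_C: "trans C s a = (if s = p \<and> a = b then Some q else trans A s a)"
  by (simp add: add_child_def)

lemma initial_C: "initial C = initial A"
  by (simp add: add_child_def)

lemma status_C: "status C s = status A s"
  by (simp add: add_child_def status_def)

lemma p_state: "p \<in> states A" "p \<noteq> q" "p \<notin> Reg"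
  using states_eq q_new path_Reg by auto

lemma trans_new: "trans A q a = None" "trans A p b = None"
  using edge_states[of q a] q_new b_max[of b] by (cases "trans A q a"; auto)+

lemma status_new: "status A q = Unknown"
  using dfa q_new by (auto simp: status_def is_3dfa_def)

lemma residual_q: "residual C q w = Unknown"
  using trans_new p_state by (cases w) (simp_all add: status_C status_new residual_Cons trans_C)

text \<open>The new edge leads to a state with residual constantly \<open>Unknown\<close>, the value
  that the undefined transition gave before.\<close>

lemma residual_C: "s \<in> states A \<Longrightarrow> residual C s w = residual A s w"
proof (induction w arbitrary: s)
  case (Cons a w)
  show ?case
    using Cons.IH edge_states[of s a] trans_new
    by (auto simp: residual_Cons trans_C residual_q split: option.split)
qed (simp add: status_C)

lemma delta_C: "delta A s w = Some t \<Longrightarrow> delta C s w = Some t"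
proof (induction w arbitrary: s)
  case (Cons a w)
  then show ?case using trans_new by (cases "trans A s a") (auto simp: trans_C)
qed simp

lemma last_letter_C: "last_letter C s = (if s = p then b else last_letter A s)"
proof (cases "s = p")
  case True
  have "dom (trans C p) = insert b (dom (trans A p))" by (auto simp: trans_C)
  moreover have "Max (insert b (dom (trans A p))) = b"
    using finite_dom[of p] b_max by (intro Max_eqI) (auto intro: less_imp_le)
  ultimately show ?thesis using True by (simp add: last_letter_def)
next
  case False
  then have "trans C s = trans A s" by (auto simp: trans_C)
  then show ?thesis using False by (simp add: last_letter_def)
qed

lemma map_last_letter_C: "map (last_letter C) (xs @ [p]) = map (last_letter A) xs @ [b]"
  using path_distinct by (auto simp: last_letter_C)

lemma verdict_C: "verdict_of C = verdict_of A"
  using residual_C[OF initial_state] by (auto simp: verdict_of_residual initial_C)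

lemma no_children_C: "\<not> has_children C q"
  using trans_new p_state by (auto simp: has_children_def trans_C)

lemma spined_C: "spined \<Sigma> C Reg (xs @ [p, q])"
proof
  show "is_3dfa \<Sigma> C"
    using dfa b_\<Sigma> p_state(1) by (auto simp: is_3dfa_def add_child_def split: if_splits)
  show "hd (xs @ [p, q]) = initial C" using path_hd initial_C by (cases xs) auto
  show "distinct (xs @ [p, q])" "set (xs @ [p, q]) \<inter> Reg = {}"
    using path_distinct path_Reg q_new states_eq by auto
  show "states C = set (xs @ [p, q]) \<union> Reg" using states_eq by (auto simp: add_child_def)
  fix s a t assume t: "trans C s a = Some t"
  show "t \<in> Reg \<or> (\<exists>xsa ys. xs @ [p, q] = xsa @ s # t # ys \<and> a = last_letter C s)"
  proof (cases "s = p")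
    case True
    then show ?thesis using t from_last[of xs p a t] last_letter_C[of p]
      by (cases "a = b") (auto simp: trans_C)
  next
    case False
    then have "trans A s a = Some t" using t trans_C[of s a] by simp
    then consider "t \<in> Reg" | xs' ys where "xs @ [p] = xs' @ s # t # ys" "a = last_letter A s"
      using edge by blast
    then show ?thesis
    proof cases
      case 2
      then have "xs @ [p, q] = xs' @ s # t # (ys @ [q])"
        by (metis append.assoc append_Cons append_Nil)
      moreover have "a = last_letter C s" using 2(2) False last_letter_C by simp
      ultimately show ?thesis by blast
    qed simp
  qed
next
  fix xs' s t ys assume e: "xs @ [p, q] = xs' @ s # t # ys"
  show "trans C s (last_letter C s) = Some t"
  proof (cases ys rule: rev_cases)
    case Nil
    then have "s = p" "t = q" using e by auto
    moreover have "trans C p (last_letter C p) = Some q" by (simp add: trans_C last_letter_C)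
    ultimately show ?thesis by simp
  next
    case (snoc ys' q')
    then have "(xs @ [p]) @ [q] = (xs' @ s # t # ys') @ [q']" using e by simp
    then have e': "xs @ [p] = xs' @ s # t # ys'" unfolding append1_eq_conv by simp
    \<comment> \<open>\<open>p\<close> ends the old path and thus lies strictly after
      \<open>s\<close>, so the changed transitions at \<open>p\<close> do not concern
      \<open>s\<close>.\<close>
    have "p \<in> set (t # ys')" using arg_cong[OF e', of last] by (auto split: if_splits)
    then have "s \<noteq> p" using path_distinct unfolding e' by auto
    then show ?thesis using path_edge[OF e'] by (simp add: trans_C last_letter_C)
  qed
next
  fix s assume "s \<in> states C"
  then consider "s \<in> states A" | "s = q" by (auto simp: add_child_def)
  then show "\<exists>x. delta C (initial C) x = Some s"
  proof cases
    case 1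
    then obtain x where "delta A (initial A) x = Some s" using reachable by blast
    then have "delta C (initial C) x = Some s" unfolding initial_C by (rule delta_C)
    then show ?thesis by blast
  next
    case 2
    \<comment> \<open>The new state is reached by the word of the old path followed by
      \<open>b\<close>.\<close>
    have "delta C (initial C) (map (last_letter A) xs @ [b]) = Some s"
      using delta_C[OF path_delta[of xs p "[]"]] 2 by (simp add: delta_append initial_C trans_C)
    then show ?thesis by blast
  qed
next
  fix s assume "s \<in> Reg"
  then have "residual C s z = residual A s z" for z by (intro residual_C) (simp add: states_eq)
  then show "\<exists>z. residual C s z \<noteq> Unknown" using Reg_nontrivial[OF \<open>s \<in> Reg\<close>] by simp
next
  fix s s' assume s: "s \<in> Reg" "s' \<in> Reg" "residual C s = residual C s'"
  have "residual C t = residual A t" if "t \<in> Reg" for t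
    by (intro ext residual_C) (use that states_eq in simp)
  then have "residual A s = residual A s'" using s by simp
  then show "s = s'" using Reg_inj s by blast
qed (use alphabet in auto)

end

definition label :: "'a list set \<Rightarrow> 'a list set \<Rightarrow> 'a list \<Rightarrow> verdict" where
  "label Sp Sn u = (if u \<in> Sp then Plus else if u \<in> Sn then Minus else Unknown)"

text \<open>Only \<open>u\<close> leads to \<open>p\<close>, so a single verdict changes; registered
  states never reach \<open>p\<close>, so their residuals are untouched.\<close>

lemma spined_mark_state:
  assumes "spined \<Sigma> A Reg (xs @ [p])"
    and u: "u = map (last_letter A) xs" "verdict_of A u = Unknown" and "Sp \<inter> Sn = {}"
  shows "spined \<Sigma> (mark_state Sp Sn u p A) Reg (xs @ [p])"
    and "verdict_of (mark_state Sp Sn u p A) = (verdict_of A)(u := label Sp Sn u)"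
proof -
  interpret spined \<Sigma> A Reg "xs @ [p]" by fact
  let ?B = "mark_state Sp Sn u p A"
  have du: "delta A (initial A) u = Some p" using path_delta[of xs p "[]"] u by simp
  then have "status A p = Unknown" using u(2) by (simp add: verdict_of_def)
  \<comment> \<open>\<open>p\<close> is still a don't-care state, so marking it cannot make the
    accepting and rejecting sets overlap.\<close>
  then have np: "p \<notin> accepting A" "p \<notin> rejecting A" by (auto simp: status_def split: if_splits)
  have simps: "trans ?B = trans A" "initial ?B = initial A" "states ?B = states A"
    by (simp_all add: mark_state_def)
  have delta: "delta ?B s w = delta A s w" for s w
    by (induction w arbitrary: s) (simp_all add: simps)
  have st: "status ?B s = (if s = p then label Sp Sn u else status A s)" for s
    using np assms(4) by (auto simp: status_def mark_state_def label_def)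
  have R: "residual ?B s w = residual A s w" if "s \<in> Reg" for s w
  proof -
    have "t \<in> Reg" if "delta A s w = Some t" for t
      using \<open>s \<in> Reg\<close> that Reg_closed by (rule delta_closed)
    then have "delta A s w \<noteq> Some p" using path_Reg by auto
    then show ?thesis by (cases "delta A s w") (simp_all add: residual_def delta st)
  qed
  show "verdict_of ?B = (verdict_of A)(u := label Sp Sn u)"
  proof
    fix w
    have "w = u" if "delta A (initial A) w = Some p"
      using path_delta_unique[of xs p "[]" w] that u by simp
    then show "verdict_of ?B w = ((verdict_of A)(u := label Sp Sn u)) w"
      using du by (cases "delta A (initial A) w") (auto simp: verdict_of_def delta st simps)
  qed
  have ll: "last_letter ?B = last_letter A" by (auto simp: last_letter_def simps)
  show "spined \<Sigma> ?B Reg (xs @ [p])"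
  proof
    have "p \<in> states A" using states_eq by auto
    then show "is_3dfa \<Sigma> ?B"
      using dfa np assms(4) by (auto simp: is_3dfa_def mark_state_def)
    fix s s' assume s: "s \<in> Reg" "s' \<in> Reg" "residual ?B s = residual ?B s'"
    then have "residual A s = residual A s'" by (auto simp: fun_eq_iff R)
    then show "s = s'" using Reg_inj s by auto
  next
    fix s a t assume "trans ?B s a = Some t"
    then show "t \<in> Reg \<or> (\<exists>xsa ys. xs @ [p] = xsa @ s # t # ys \<and> a = last_letter ?B s)"
      unfolding simps ll by (rule edge)
  next
    fix xs' s t ys assume "xs @ [p] = xs' @ s # t # ys"
    then show "trans ?B s (last_letter ?B s) = Some t" unfolding simps ll by (rule path_edge)
  next
    fix s assume "s \<in> states ?B"
    then show "\<exists>x. delta ?B (initial ?B) x = Some s" unfolding simps delta by (rule reachable)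
  next
    fix s assume "s \<in> Reg"
    then show "\<exists>z. residual ?B s z \<noteq> Unknown" using Reg_nontrivial by (simp add: R)
  qed (use alphabet path_hd path_distinct path_Reg states_eq in \<open>simp_all add: simps\<close>)
qed

text \<open>The sample \<open>u\<close> stays fixed while the boundary between path word and
  \<open>y\<close> moves right. The case condition lets \<open>p\<close> end the path if
  \<open>y\<close> is empty, and otherwise supplies \<open>b_max\<close> for the first new
  edge.\<close>

lemma add_suffix_spined:
  assumes "spined \<Sigma> A Reg (xs @ [p])"
    and "u = map (last_letter A) xs @ y" "verdict_of A u = Unknown" "Sp \<inter> Sn = {}"
    and "y \<in> lists \<Sigma>"
    and "case y of [] \<Rightarrow> \<not> has_children A p | b # _ \<Rightarrow> \<forall>c\<in>dom (trans A p). c < b"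
  shows "\<exists>ps. ps \<noteq> [] \<and> spined \<Sigma> (add_suffix Sp Sn u A p y) Reg ps \<and>
    map (last_letter (add_suffix Sp Sn u A p y)) (butlast ps) = u \<and>
    \<not> has_children (add_suffix Sp Sn u A p y) (last ps) \<and>
    verdict_of (add_suffix Sp Sn u A p y) = (verdict_of A)(u := label Sp Sn u)"
  using assms
proof (induction y arbitrary: A xs p)
  case Nil
  have u: "u = map (last_letter A) xs" using Nil by simp
  have t: "trans (mark_state Sp Sn u p A) = trans A" by (simp add: mark_state_def)
  then have l: "last_letter (mark_state Sp Sn u p A) = last_letter A"
    by (auto simp: last_letter_def)
  have "map (last_letter (mark_state Sp Sn u p A)) (butlast (xs @ [p])) = u"
    using u l by simp
  moreover have "\<not> has_children (mark_state Sp Sn u p A) (last (xs @ [p]))"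
    using Nil.prems(6) t by (simp add: has_children_def)
  ultimately show ?case
    using spined_mark_state[OF Nil.prems(1) u Nil.prems(3,4)] unfolding add_suffix.simps by blast
next
  case (Cons b y)
  have f: "fresh A \<notin> states A"
    using spined.dfa[OF Cons.prems(1)] by (intro fresh_not_in) (simp add: is_3dfa_def)
  interpret spined_extend \<Sigma> A Reg xs p b "fresh A"
    using Cons.prems f by (auto simp: spined_extend_def spined_extend_axioms_def)
  have a: "add_suffix Sp Sn u A p (b # y) = add_suffix Sp Sn u C (fresh A) y"
    by (simp add: Let_def)
  have d: "dom (trans C (fresh A)) = {}" using no_children_C by (simp add: has_children_def)
  have "\<exists>ps. ps \<noteq> [] \<and> spined \<Sigma> (add_suffix Sp Sn u C (fresh A) y) Reg ps \<and>
    map (last_letter (add_suffix Sp Sn u C (fresh A) y)) (butlast ps) = u \<and>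
    \<not> has_children (add_suffix Sp Sn u C (fresh A) y) (last ps) \<and>
    verdict_of (add_suffix Sp Sn u C (fresh A) y) = (verdict_of C)(u := label Sp Sn u)"
  proof (rule Cons.IH[of C "xs @ [p]"])
    show "spined \<Sigma> C Reg ((xs @ [p]) @ [fresh A])" using spined_C by simp
    show "u = map (last_letter C) (xs @ [p]) @ y"
      using map_last_letter_C Cons.prems(2) by simp
    show "verdict_of C u = Unknown" using verdict_C Cons.prems(3) by simp
    \<comment> \<open>From the second letter on, the condition holds vacuously because a fresh state
      has no children.\<close>
    show "case y of [] \<Rightarrow> \<not> has_children C (fresh A)
      | b # _ \<Rightarrow> \<forall>c\<in>dom (trans C (fresh A)). c < b"
      using no_children_C d by (simp split: list.split)
  qed (use Cons.prems in auto)
  then show ?case unfolding a verdict_C .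
qed

section \<open>The invariant of the main loop\<close>

text \<open>\<open>V\<close> holds the samples read so far. The letters leaving all path states but
  the last spell the largest of them, with \<open>[]\<close> as default before the first
  sample.\<close>

definition processed ::
  "'a::linorder set \<Rightarrow> 'a list set \<Rightarrow> 'a list set \<Rightarrow> 'a list set \<Rightarrow> (nat, 'a) tdfa \<times> nat set \<Rightarrow> bool"
  where "processed \<Sigma> Sp Sn V c \<longleftrightarrow> (\<exists>ps. spined \<Sigma> (fst c) (snd c) ps \<and> nontrivial (fst c) \<and>
     \<not> has_children (fst c) (last ps) \<and>
     (\<forall>v\<in>V. v = map (last_letter (fst c)) (butlast ps) \<or>
        lex_less v (map (last_letter (fst c)) (butlast ps))) \<and>
     map (last_letter (fst c)) (butlast ps) \<in> insert [] V \<and>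
     (\<forall>w. verdict_of (fst c) w = (if w \<in> V then label Sp Sn w else Unknown)))"

text \<open>For a state on the path, the remainder of the path word is a continuation with a known
  verdict.\<close>

lemma nontrivial_if_path_word:
  assumes "spined \<Sigma> A Reg ps" "verdict_of A (map (last_letter A) (butlast ps)) \<noteq> Unknown"
  shows "nontrivial A"
  unfolding nontrivial_def
proof (intro ballI impI)
  interpret spined \<Sigma> A Reg ps by fact
  fix q assume "q \<in> states A"
  then consider "q \<in> Reg" | "q \<in> set ps" using states_eq by auto
  then show "\<exists>z. residual A q z \<noteq> Unknown"
  proof cases
    case 2
    then obtain xs ys where ps: "ps = xs @ q # ys" by (meson split_list)
    then have "map (last_letter A) (butlast ps) =
        map (last_letter A) xs @ map (last_letter A) (butlast (q # ys))"
      by (simp add: butlast_append)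
    then show ?thesis
      using assms(2) path_delta[OF ps] by (auto simp: verdict_of_residual residual_append)
  qed (rule Reg_nontrivial)
qed

text \<open>Sortedness enters twice: it places \<open>p\<close> on the active path, and it bounds
  the letters leaving \<open>p\<close> by the next letter of \<open>u\<close>.\<close>

lemma process_sample_processed:
  assumes "processed \<Sigma> Sp Sn V c" "Sp \<inter> Sn = {}" "u \<in> Sp \<union> Sn" "u \<in> lists \<Sigma>"
    and less: "\<And>v. v \<in> V \<Longrightarrow> lex_less v u"
  shows "\<exists>c'. process_sample \<Sigma> Sp Sn u c = Some c' \<and> processed \<Sigma> Sp Sn (insert u V) c'"
proof -
  obtain A Reg where c: "c = (A, Reg)" by (cases c)
  obtain ps where ps: "spined \<Sigma> A Reg ps" and nt: "nontrivial A"
    and nc: "\<not> has_children A (last ps)"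
    and le: "\<forall>v\<in>V. v = map (last_letter A) (butlast ps) \<or>
        lex_less v (map (last_letter A) (butlast ps))"
    and wV: "map (last_letter A) (butlast ps) \<in> insert [] V"
    and ver: "\<And>w. verdict_of A w = (if w \<in> V then label Sp Sn w else Unknown)"
    using assms(1) unfolding processed_def c fst_conv snd_conv by blast
  interpret spined \<Sigma> A Reg ps by fact
  define w where "w = map (last_letter A) (butlast ps)"
  define n where "n = longest_prefix_length A u"
  define x where "x = take n u"
  define y where "y = drop n u"
  have uxy: "u = x @ y" by (simp add: x_def y_def)
  have uV: "u \<notin> V" using less lex_less_irrefl by blast
  \<comment> \<open>The empty prefix is readable and \<open>length u\<close> is a bound, so
    \<open>GREATEST\<close> is attained.\<close>
  have n: "n \<le> length u \<and> delta A (initial A) (take n u) \<noteq> None"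
    unfolding n_def longest_prefix_length_def
    by (rule GreatestI_nat[where k=0 and b="length u"]) auto
  then obtain p where p: "delta A (initial A) x = Some p" unfolding x_def by auto
  have maximal: "trans A p b = None" if "y = b # y'" for b y'
  proof (rule ccontr)
    assume "trans A p b \<noteq> None"
    then obtain t where t: "trans A p b = Some t" by auto
    have l: "n < length u" using that unfolding y_def by (cases "n < length u") auto
    then have "take (Suc n) u = x @ [b]"
      using that unfolding x_def y_def by (simp add: take_Suc_conv_app_nth nth_via_drop)
    then have "delta A (initial A) (take (Suc n) u) \<noteq> None" using p t by (simp add: delta_append)
    then have "Suc n \<le> n"
      unfolding n_def longest_prefix_length_def using l
      by (intro Greatest_le_nat[where b="length u"]) (auto simp: n_def longest_prefix_length_def)
    then show False by simp
  qed
  \<comment> \<open>A nonempty readable word leads to a noninitial, hence nontrivial, state, so it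
    is a prefix of a processed sample.\<close>
  have ext: "\<exists>z. v @ z \<in> V" if "delta A (initial A) v = Some s" "v \<noteq> []" for v s
  proof -
    have "s \<noteq> initial A" using initial_unique that by auto
    moreover have "s \<in> states A" using delta_states[OF dfa initial_state that(1)] .
    ultimately obtain z where "residual A s z \<noteq> Unknown" using nt by (auto simp: nontrivial_def)
    then have "verdict_of A (v @ z) \<noteq> Unknown"
      using that by (simp add: verdict_of_residual residual_append)
    then show ?thesis using ver by (metis (full_types))
  qed
  have "\<exists>z. w = x @ z"
  proof (cases "x = []")
    case False
    then obtain z where z: "x @ z \<in> V" using ext p by blast
    \<comment> \<open>\<open>x @ z\<close> is nonempty and at most \<open>w\<close>, so
      \<open>w\<close> is a processed sample and not the default \<open>[]\<close>.\<close>
    then have "w \<in> V" using wV le unfolding w_def by auto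
    then show ?thesis
      using lex_less_convex_prefix[of "x @ z" w u x z y] z le less uxy unfolding w_def by auto
  qed simp
  then obtain z where z: "w = x @ z" by blast
  define xs where "xs = take (length x) ps"
  \<comment> \<open>\<open>w\<close> has one letter fewer than the path has states, so a path state
    exists at position \<open>length x\<close>.\<close>
  have lx: "length x < length ps"
    using arg_cong[OF z, of length] path_nonempty unfolding w_def
    by (cases ps rule: rev_cases) auto
  have psx: "ps = xs @ ps ! length x # drop (Suc (length x)) ps"
    using lx unfolding xs_def by (rule id_take_nth_drop)
  have "xs = take (length x) (butlast ps)"
    using lx unfolding xs_def by (simp add: take_butlast)
  then have "map (last_letter A) xs = take (length x) w"
    unfolding w_def by (simp add: take_map)
  then have xx: "map (last_letter A) xs = x" using z by simp
  then have "p = ps ! length x" using path_delta[OF psx] p by simp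
  then obtain ys where ys: "ps = xs @ p # ys" using psx by blast
  obtain A1 Reg1 where
    1: "(if has_children A p then replace_or_register \<Sigma> (A, Reg) p else Some (A, Reg))
        = Some (A1, Reg1)"
    "spined \<Sigma> A1 Reg1 (xs @ [p])" "nontrivial A1" "verdict_of A1 = verdict_of A"
    "\<forall>s\<in>set (xs @ [p]). dom (trans A1 s) = dom (trans A s)"
  proof (cases ys)
    case Nil
    then have "\<not> has_children A p" using nc ys by simp
    then show ?thesis using that[of A Reg] ps nt ys Nil by auto
  next
    case (Cons r ys')
    have "has_children A p" using path_edge[of xs p r ys'] ys Cons by (auto simp: has_children_def)
    then show ?thesis
      using that replace_or_register_spined[of \<Sigma> A Reg xs p r ys'] ps nt nc ys Cons by auto
  qed
  \<comment> \<open>\<open>last_letter\<close> depends only on the domain of the transitions, which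
    the call has preserved along \<open>xs @ [p]\<close>.\<close>
  have ux: "u = map (last_letter A1) xs @ y"
    using 1(5) xx uxy by (auto simp: last_letter_def)
  have y: "case y of [] \<Rightarrow> \<not> has_children A1 p | b # _ \<Rightarrow> \<forall>c\<in>dom (trans A1 p). c < b"
  proof -
    have d: "dom (trans A1 p) = dom (trans A p)" using 1(5) by simp
    \<comment> \<open>A letter leaving \<open>p\<close> continues to a processed sample with prefix
      \<open>x @ [c]\<close>; that sample is smaller than \<open>u\<close>, and cancelling
      \<open>x\<close> compares its remainder with \<open>y\<close>. For empty \<open>y\<close> this
      is impossible, so \<open>p\<close> is then childless.\<close>
    have below: "\<exists>z. lex_less (c # z) y" if c: "c \<in> dom (trans A p)" for c
    proof -
      obtain t where "trans A p c = Some t" using c by auto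
      then have "delta A (initial A) (x @ [c]) = Some t" using p by (simp add: delta_append)
      then obtain z where "(x @ [c]) @ z \<in> V" using ext by blast
      then have "lex_less (x @ (c # z)) (x @ y)" using less[of "(x @ [c]) @ z"] uxy by simp
      then show ?thesis unfolding lex_less_append_left by blast
    qed
    show ?thesis
    proof (cases y)
      case Nil
      then show ?thesis using below d by (auto simp: has_children_def)
    next
      case (Cons b y')
      \<comment> \<open>The order alone allows \<open>c = b\<close>, which the maximality of the
        readable prefix excludes.\<close>
      have "c < b" if "c \<in> dom (trans A p)" for c
        using below[OF that] that maximal[OF Cons] Cons by auto
      then show ?thesis using Cons d by simp
    qed
  qed
  define A2 where "A2 = add_suffix Sp Sn u A1 p y"
  have "verdict_of A1 u = Unknown" using 1(4) ver uV by simp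
  moreover have "y \<in> lists \<Sigma>" using assms(4) uxy by auto
  ultimately obtain qs where qs: "qs \<noteq> []" "spined \<Sigma> A2 Reg1 qs"
    "map (last_letter A2) (butlast qs) = u" "\<not> has_children A2 (last qs)"
    "verdict_of A2 = (verdict_of A1)(u := label Sp Sn u)"
    using add_suffix_spined[OF 1(2) ux _ assms(2) _ y] unfolding A2_def by blast
  have "process_sample \<Sigma> Sp Sn u c = Some (A2, Reg1)"
    using 1(1) p unfolding process_sample_def c A2_def
    by (cases "has_children A p") (simp_all add: Let_def x_def y_def n_def)
  moreover have "nontrivial A2"
    by (rule nontrivial_if_path_word[OF qs(2)]) (use qs(3,5) assms(3) in \<open>auto simp: label_def\<close>)
  moreover have "verdict_of A2 v = (if v \<in> insert u V then label Sp Sn v else Unknown)" for v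
    using qs(5) 1(4) ver by simp
  ultimately show ?thesis
    using qs less by (intro exI[of _ "(A2, Reg1)"]) (auto simp: processed_def)
qed

lemma process_samples_processed:
  assumes "processed \<Sigma> Sp Sn V c" "Sp \<inter> Sn = {}" "set us \<subseteq> Sp \<union> Sn" "set us \<subseteq> lists \<Sigma>"
    and "sorted_wrt lex_less us" "\<And>u v. u \<in> set us \<Longrightarrow> v \<in> V \<Longrightarrow> lex_less v u"
  shows "\<exists>c'. process_samples \<Sigma> Sp Sn us c = Some c' \<and> processed \<Sigma> Sp Sn (V \<union> set us) c'"
  using assms
proof (induction us arbitrary: V c)
  case (Cons u us)
  obtain c1 where c1: "process_sample \<Sigma> Sp Sn u c = Some c1" "processed \<Sigma> Sp Sn (insert u V) c1"
    using process_sample_processed[OF Cons.prems(1,2), of u] Cons.prems by auto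
  have "lex_less v u'" if "u' \<in> set us" "v \<in> insert u V" for u' v
    using that Cons.prems(5,6) by auto
  then obtain c' where "process_samples \<Sigma> Sp Sn us c1 = Some c'"
    "processed \<Sigma> Sp Sn (insert u V \<union> set us) c'"
    using Cons.IH[OF c1(2)] Cons.prems(2-5) by fastforce
  then show ?case using c1 by (intro exI[of _ c']) auto
qed auto

lemma processed_start:
  fixes \<Sigma> :: "'a::linorder set"
  assumes "finite \<Sigma>"
  shows "processed \<Sigma> Sp Sn {} (start_tdfa, {})"
proof -
  have "spined \<Sigma> (start_tdfa :: (nat, 'a) tdfa) {} [0]"
    by standard
      (use assms in \<open>auto simp: start_tdfa_def is_3dfa_def intro: exI[of _ "[]"]\<close>)
  moreover have "verdict_of start_tdfa w = Unknown" for w :: "'a list"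
    by (cases w) (simp_all add: verdict_of_def start_tdfa_def status_def)
  ultimately show ?thesis
    by (auto simp: processed_def nontrivial_def has_children_def start_tdfa_def intro!: exI[of _ "[0]"])
qed

section \<open>Minimality by comparing residuals\<close>

text \<open>Send a state of \<open>M\<close> to the state of \<open>N\<close> reached by a word that reaches it; the images of
  distinct states have distinct residuals.\<close>

lemma card_states_le_if_residual_inj:
  assumes M: "is_3dfa \<Sigma> M" and N: "is_3dfa \<Sigma> N"
    and eq: "\<And>w. verdict_of M w = verdict_of N w"
    and reach: "\<And>q. q \<in> states M \<Longrightarrow> \<exists>x. delta M (initial M) x = Some q"
    and nontriv: "\<And>q. q \<in> states M \<Longrightarrow> \<exists>z. residual M q z \<noteq> Unknown"
    and inj: "inj_on (residual M) (states M)"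
  shows "card (states M) \<le> card (states N)"
proof -
  obtain f where f: "\<And>q. q \<in> states M \<Longrightarrow> delta M (initial M) (f q) = Some q"
    using reach by metis
  define g where "g q = the (delta N (initial N) (f q))" for q
  have e: "residual M q z = verdict_of N (f q @ z)" if "q \<in> states M" for q z
    using f[OF that] eq[of "f q @ z"] by (simp add: verdict_of_residual residual_append)
  \<comment> \<open>\<open>N\<close> cannot block on \<open>f q\<close>, since some extension of
    that word has a known verdict; so \<open>the\<close> in \<open>g\<close> is applied to a defined
    value.\<close>
  have g: "delta N (initial N) (f q) = Some (g q)" if q: "q \<in> states M" for q
  proof -
    obtain z where "residual M q z \<noteq> Unknown" using nontriv[OF q] by blast
    then have "verdict_of N (f q @ z) \<noteq> Unknown" using e[OF q] by simp
    then show ?thesis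
      unfolding g_def verdict_of_residual residual_append by (auto split: option.splits)
  qed
  have r: "residual M q = residual N (g q)" if "q \<in> states M" for q
    using e[OF that] g[OF that] by (auto simp: verdict_of_residual residual_append)
  show ?thesis
  proof (rule card_inj_on_le[of g])
    show "inj_on g (states M)"
      by (rule inj_onI) (metis r inj inj_onD)
    show "g ` states M \<subseteq> states N"
      using g delta_states[OF N] N by (auto simp: is_3dfa_def)
    show "finite (states N)" using N by (simp add: is_3dfa_def)
  qed
qed

text \<open>\<open>recognises\<close> speaks of words over \<open>\<Sigma>\<close> only; on all
  others no run exists and no sample occurs, so both sides are \<open>Unknown\<close>.\<close>

lemma recognises_verdict:
  assumes "is_3dfa \<Sigma> N" "recognises \<Sigma> N Sp Sn" "Sp \<subseteq> lists \<Sigma>" "Sn \<subseteq> lists \<Sigma>"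
  shows "verdict_of N w = label Sp Sn w"
proof (cases "w \<in> lists \<Sigma>")
  case True
  then show ?thesis using assms(2) by (simp add: recognises_def label_def)
next
  case False
  then have "delta N (initial N) w = None" using delta_in_lists[OF assms(1)] by blast
  then show ?thesis using False assms(3,4) by (auto simp: verdict_of_def label_def)
qed

text \<open>Once the path is just the initial state, all other states are registered and have
  distinct residuals, so only the initial state remains to be separated from them.\<close>

lemma spined_singleton_minimal:
  fixes M :: "('q, 'a::linorder) tdfa" and N :: "('r, 'a) tdfa"
  assumes "spined \<Sigma> M Reg ps" "ps = [initial M]"
    and N: "is_3dfa \<Sigma> N" and eq: "\<And>w. verdict_of M w = verdict_of N w"
    and fin: "finite {w. verdict_of M w \<noteq> Unknown}"
  shows "card (states M) \<le> card (states N)"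
proof -
  interpret spined \<Sigma> M Reg ps by fact
  have st: "states M = insert (initial M) Reg" using states_eq assms(2) by simp
  have iR: "initial M \<notin> Reg" using path_Reg assms(2) by simp
  show ?thesis
  proof (cases "Reg = {}")
    case True
    \<comment> \<open>\<open>M\<close> has a single state here, and \<open>N\<close> has at least
      its initial state.\<close>
    have "card (states N) > 0" using N by (auto simp: is_3dfa_def card_gt_0_iff)
    then show ?thesis using True st by simp
  next
    case False
    have verdict_via: "verdict_of M (x @ z) = residual M q z"
      if "delta M (initial M) x = Some q" for x q z
      using that by (simp add: verdict_of_residual residual_append)
    have ex: "\<exists>z. verdict_of M z \<noteq> Unknown"
    proof -
      obtain q where q: "q \<in> Reg" using False by blast
      then obtain z where z: "residual M q z \<noteq> Unknown" using Reg_nontrivial by blast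
      obtain x where "delta M (initial M) x = Some q" using reachable[of q] q st by blast
      then show ?thesis using verdict_via[of x q z] z by metis
    qed
    \<comment> \<open>If the residuals agreed, prepending the nonempty word \<open>x\<close> that
      leads to \<open>q\<close> to a longest word with known verdict would give a longer such
      word.\<close>
    have ne: "residual M (initial M) \<noteq> residual M q" if q: "q \<in> Reg" for q
    proof
      assume r: "residual M (initial M) = residual M q"
      obtain x where x: "delta M (initial M) x = Some q" using reachable[of q] q st by blast
      have "x \<noteq> []" using x q iR by auto
      obtain z where z: "verdict_of M z \<noteq> Unknown"
        and zmax: "\<And>w. verdict_of M w \<noteq> Unknown \<Longrightarrow> length w \<le> length z"
      proof -
        let ?L = "length ` {w. verdict_of M w \<noteq> Unknown}"
        have "finite ?L" "?L \<noteq> {}" using fin ex by auto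
        then have "Max ?L \<in> ?L" "\<forall>l\<in>?L. l \<le> Max ?L" by auto
        then show ?thesis using that by auto
      qed
      have "verdict_of M (x @ z) \<noteq> Unknown"
        using verdict_via[OF x] r z by (simp add: verdict_of_residual)
      then show False using zmax[of "x @ z"] \<open>x \<noteq> []\<close> by simp
    qed
    have "inj_on (residual M) (states M)"
      unfolding st by (rule inj_onI) (metis Reg_inj ne insertE)
    moreover have "\<exists>z. residual M q z \<noteq> Unknown" if "q \<in> states M" for q
      using that st ex Reg_nontrivial by (auto simp: verdict_of_residual)
    ultimately show ?thesis
      by (intro card_states_le_if_residual_inj[OF dfa N eq reachable])
  qed
qed

theorem theorem3:
  fixes \<Sigma> :: "'a::linorder set"
    and Sp Sn :: "'a list set"
    and us :: "'a list list"
  assumes "finite \<Sigma>"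
    and "Sp \<subseteq> lists \<Sigma>" and "Sn \<subseteq> lists \<Sigma>"
    and "finite Sp" and "finite Sn"
    and "Sp \<inter> Sn = {}"
    and "set us = Sp \<union> Sn"
    and "sorted_wrt lex_less us"
  shows "\<exists>M. construct \<Sigma> Sp Sn us = Some M \<and>
           is_3dfa \<Sigma> M \<and>
           recognises \<Sigma> M Sp Sn \<and>
           (\<forall>N :: ('q, 'a) tdfa. is_3dfa \<Sigma> N \<and> recognises \<Sigma> N Sp Sn \<longrightarrow>
              card (states M) \<le> card (states N))"
proof -
  obtain A Reg where A: "process_samples \<Sigma> Sp Sn us (start_tdfa, {}) = Some (A, Reg)"
    "processed \<Sigma> Sp Sn (set us) (A, Reg)"
    using process_samples_processed[OF processed_start[OF assms(1)] assms(6), of us] assms by auto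
  obtain ps where ps: "spined \<Sigma> A Reg ps" "nontrivial A" "\<not> has_children A (last ps)"
    and ver: "\<And>w. verdict_of A w = (if w \<in> set us then label Sp Sn w else Unknown)"
    using A(2) unfolding processed_def fst_conv snd_conv by blast
  interpret spined \<Sigma> A Reg ps by fact
  \<comment> \<open>The final call shrinks the path to the initial state; if the path is that short
    already, the state is childless and no call is made.\<close>
  obtain M Reg' where
    M: "(if has_children A (initial A) then replace_or_register \<Sigma> (A, Reg) (initial A)
         else Some (A, Reg)) = Some (M, Reg')"
    "spined \<Sigma> M Reg' [initial A]" "verdict_of M = verdict_of A"
  proof (cases "tl ps")
    case Nil
    then have "ps = [initial A]" using path_nonempty path_hd by (cases ps) auto
    then show ?thesis using that[of A Reg] ps by auto
  next
    case (Cons r ys)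
    then have e: "ps = [] @ initial A # r # ys" using path_nonempty path_hd by (cases ps) auto
    then have "has_children A (initial A)" using path_edge[OF e] by (auto simp: has_children_def)
    then show ?thesis
      using that replace_or_register_spined[of \<Sigma> A Reg "[]" "initial A" r ys] ps e by auto
  qed
  interpret M: spined \<Sigma> M Reg' "[initial A]" by fact
  have i: "[initial A] = [initial M]" using M.path_hd by simp
  have verM: "verdict_of M w = label Sp Sn w" for w
    using ver M(3) assms(7) by (auto simp: label_def)
  have "construct \<Sigma> Sp Sn us = Some M" using A(1) M(1) by (simp add: construct_def)
  moreover have "recognises \<Sigma> M Sp Sn" using verM by (simp add: recognises_def label_def)
  moreover have "card (states M) \<le> card (states N)"
    if N: "is_3dfa \<Sigma> N" "recognises \<Sigma> N Sp Sn" for N :: "('q, 'a) tdfa"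
  proof (rule spined_singleton_minimal[OF M(2) i N(1)])
    show "verdict_of M w = verdict_of N w" for w
      using verM recognises_verdict[OF N assms(2,3)] by simp
    have "{w. verdict_of M w \<noteq> Unknown} \<subseteq> Sp \<union> Sn" by (auto simp: verM label_def)
    then show "finite {w. verdict_of M w \<noteq> Unknown}"
      using assms(4,5) by (meson finite_UnI finite_subset)
  qed
  ultimately show ?thesis using M.dfa by blast
qed

end
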